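(* (Disjunction Property) If $\emptyset\vdash^+A\vee B$, then $\emptyset\vdash^+A$ or $\emptyset\vdash^+B$. (Existence Property) If $\emptyset\vdash^+\exists xA(x)$, then there exists a closed term $t$ such that $\emptyset\vdash^+A(t)$.
   Context: Formulas are those of first-order predicate logic, built from atomic formulas with $\wedge,\vee,\Rightarrow,\exists,\forall$. A $\Sigma$-formula is a formula containing neither $\Rightarrow$ nor $\forall$. A closed term is an individual term containing no variables. The system $\mathrm{MQC}^+$ is minimal intuitionistic predicate logic extended with two rules, reset and shift. Only one formula, a $\Sigma$-formula $T$ set once and for all, may occur as an annotation in a derivation. Sequents have the form $\Gamma\vdash_\diamond A$, where $\Gamma$ is a context of formulas, and $\diamond$ is either the annotation $T$ (written $\Gamma\vdash_T A$) or absent (written $\Gamma\vdash A$). In the rules below, apart from reset and shift, $\diamond$ is the same in all premises and in the conclusion: - Ax: $\Gamma\vdash_\diamond A$ if $A\in\Gamma$. - $\wedge_I$: from $\Gamma\vdash_\diamond A_1$ and $\Gamma\vdash_\diamond A_2$ infer $\Gamma\vdash_\diamond A_1\wedge A_2$. $\wedge_E^i$ ($i=1,2$): from $\Gamma\vdash_\diamond A_1\wedge A_2$ infer $\Gamma\vdash_\diamond A_i$. - $\vee_I^i$ ($i=1,2$): from $\Gamma\vdash_\diamond A_i$ infer $\Gamma\vdash_\diamond A_1\vee A_2$. $\vee_E$: from $\Gamma\vdash_\diamond A_1\vee A_2$, $\Gamma,A_1\vdash_\diamond C$ and $\Gamma,A_2\vdash_\diamond C$ infer $\Gamma\vdash_\diamond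 C$. - $\Rightarrow_I$: from $\Gamma,A_1\vdash_\diamond A_2$ infer $\Gamma\vdash_\diamond A_1\Rightarrow A_2$. $\Rightarrow_E$: from $\Gamma\vdash_\diamond A_1\Rightarrow A_2$ and $\Gamma\vdash_\diamond A_1$ infer $\Gamma\vdash_\diamond A_2$. - $\forall_I$: from $\Gamma\vdash_\diamond A(x)$ with $x$ fresh infer $\Gamma\vdash_\diamond\forall x A(x)$. $\forall_E$: from $\Gamma\vdash_\diamond\forall xA(x)$ infer $\Gamma\vdash_\diamond A(t)$. - $\exists_I$: from $\Gamma\vdash_\diamond A(t)$ infer $\Gamma\vdash_\diamond\exists xA(x)$. $\exists_E$: from $\Gamma\vdash_\diamond\exists xA(x)$ and $\Gamma,A(x)\vdash_\diamond C$ with $x$ fresh infer $\Gamma\vdash_\diamond C$. - Reset ($\#$): from $\Gamma\vdash_T T$ infer $\Gamma\vdash_\diamond T$ (with $\diamond$ either $T$ or absent). - Shift ($\mathcal S$): from $\Gamma,A\Rightarrow T\vdash_T T$ infer $\Gamma\vdash_T A$. Here "$x$ fresh" is the usual eigenvariable condition: $x$ does not occur free in the conclusion sequent of the rule (including its annotation, if present). $\emptyset\vdash^+A$ means that $A$ is derivable in $\mathrm{MQC}^+$ from the empty context, with no annotation on the turnstile of the final sequent.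
   Formalization: The existence property is proved for closed formulas ∃xA(x) in a language having at least one closed term; without these it fails, e.g. for ∃x(P(y)⇒P(x)), or for ∃x(P(x)⇒P(x)) when there are no closed terms. *)

theory Defs
  imports Main
begin

text \<open>
  Terms and formulas are in de Bruijn form. An index that is not captured by a
  quantifier plays the part of a named free variable, so the free variables of a formula
  are natural numbers, and formulas are identified up to renaming of bound variables.
\<close>

datatype 'f tm = Var nat | Fun 'f "'f tm list"

datatype ('f, 'p) fm =
    Pred 'p "'f tm list"
  | And "('f, 'p) fm" "('f, 'p) fm"
  | Or "('f, 'p) fm" "('f, 'p) fm"
  | Imp "('f, 'p) fm" "('f, 'p) fm"
  | Ex "('f, 'p) fm"
  | All "('f, 'p) fm"

text \<open>
  A language is given by a set \<open>F\<close> of function symbols with their arities (arity 0: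
  constants) and a set \<open>P\<close> of predicate symbols with their arities. Either set may be
  empty, so languages without closed terms are included.
\<close>

primrec wf_tm :: "('f \<times> nat) set \<Rightarrow> 'f tm \<Rightarrow> bool" where
  "wf_tm F (Var n) \<longleftrightarrow> True"
| "wf_tm F (Fun f ts) \<longleftrightarrow> (f, length ts) \<in> F \<and> list_all (wf_tm F) ts"

primrec wf_fm :: "('f \<times> nat) set \<Rightarrow> ('p \<times> nat) set \<Rightarrow> ('f, 'p) fm \<Rightarrow> bool" where
  "wf_fm F P (Pred p ts) \<longleftrightarrow> (p, length ts) \<in> P \<and> list_all (wf_tm F) ts"
| "wf_fm F P (And A B) \<longleftrightarrow> wf_fm F P A \<and> wf_fm F P B"
| "wf_fm F P (Or A B) \<longleftrightarrow> wf_fm F P A \<and> wf_fm F P B"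
| "wf_fm F P (Imp A B) \<longleftrightarrow> wf_fm F P A \<and> wf_fm F P B"
| "wf_fm F P (Ex A) \<longleftrightarrow> wf_fm F P A"
| "wf_fm F P (All A) \<longleftrightarrow> wf_fm F P A"

primrec fv_tm :: "'f tm \<Rightarrow> nat set" where
  "fv_tm (Var n) = {n}"
| "fv_tm (Fun f ts) = \<Union> (set (map fv_tm ts))"

primrec fv_fm :: "('f, 'p) fm \<Rightarrow> nat set" where
  "fv_fm (Pred p ts) = \<Union> (set (map fv_tm ts))"
| "fv_fm (And A B) = fv_fm A \<union> fv_fm B"
| "fv_fm (Or A B) = fv_fm A \<union> fv_fm B"
| "fv_fm (Imp A B) = fv_fm A \<union> fv_fm B"
| "fv_fm (Ex A) = {n. Suc n \<in> fv_fm A}"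
| "fv_fm (All A) = {n. Suc n \<in> fv_fm A}"

definition closed_tm :: "('f \<times> nat) set \<Rightarrow> 'f tm \<Rightarrow> bool" where
  "closed_tm F t \<longleftrightarrow> wf_tm F t \<and> fv_tm t = {}"

primrec subst_tm :: "(nat \<Rightarrow> 'f tm) \<Rightarrow> 'f tm \<Rightarrow> 'f tm" where
  "subst_tm \<sigma> (Var n) = \<sigma> n"
| "subst_tm \<sigma> (Fun f ts) = Fun f (map (subst_tm \<sigma>) ts)"

definition lift_subst :: "(nat \<Rightarrow> 'f tm) \<Rightarrow> nat \<Rightarrow> 'f tm" where
  "lift_subst \<sigma> = case_nat (Var 0) (\<lambda>n. subst_tm (\<lambda>m. Var (Suc m)) (\<sigma> n))"

primrec subst_fm :: "(nat \<Rightarrow> 'f tm) \<Rightarrow> ('f, 'p) fm \<Rightarrow> ('f, 'p) fm" where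
  "subst_fm \<sigma> (Pred p ts) = Pred p (map (subst_tm \<sigma>) ts)"
| "subst_fm \<sigma> (And A B) = And (subst_fm \<sigma> A) (subst_fm \<sigma> B)"
| "subst_fm \<sigma> (Or A B) = Or (subst_fm \<sigma> A) (subst_fm \<sigma> B)"
| "subst_fm \<sigma> (Imp A B) = Imp (subst_fm \<sigma> A) (subst_fm \<sigma> B)"
| "subst_fm \<sigma> (Ex A) = Ex (subst_fm (lift_subst \<sigma>) A)"
| "subst_fm \<sigma> (All A) = All (subst_fm (lift_subst \<sigma>) A)"

text \<open>
  If \<open>A\<close> is the body of a quantified formula \<open>Qx A(x)\<close>, then \<open>inst A t\<close> is \<open>A(t)\<close>:
  index 0 is replaced by \<open>t\<close> and the index \<open>n + 1\<close>, which refers to the free variable \<open>n\<close>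
  of the quantified formula, is lowered to \<open>n\<close>.
\<close>

definition inst :: "('f, 'p) fm \<Rightarrow> 'f tm \<Rightarrow> ('f, 'p) fm" where
  "inst A t = subst_fm (case_nat t Var) A"

primrec sigma_fm :: "('f, 'p) fm \<Rightarrow> bool" where
  "sigma_fm (Pred p ts) \<longleftrightarrow> True"
| "sigma_fm (And A B) \<longleftrightarrow> sigma_fm A \<and> sigma_fm B"
| "sigma_fm (Or A B) \<longleftrightarrow> sigma_fm A \<and> sigma_fm B"
| "sigma_fm (Imp A B) \<longleftrightarrow> False"
| "sigma_fm (Ex A) \<longleftrightarrow> sigma_fm A"
| "sigma_fm (All A) \<longleftrightarrow> False"

text \<open>
  \<open>mqcp F P T \<Gamma> d A\<close> is derivability in MQC+ of the sequent with context \<open>\<Gamma>\<close> and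
  succedent \<open>A\<close> in the language \<open>F\<close>, \<open>P\<close>. The Boolean \<open>d\<close> tells whether the turnstile
  carries the annotation \<open>T\<close>; no other annotation exists. \<open>T\<close> may have free variables,
  and these restrict the eigenvariables only where the annotation is present.

  In \<open>AllI\<close> and \<open>ExE\<close> the quantified formula occurs among the formulas in which the
  eigenvariable \<open>x\<close> must not be free: with named variables this holds
  automatically, because \<open>x\<close> is the variable bound there.
  The side conditions on well-formedness confine derivations to the formulas
  of the language.
\<close>

definition fresh :: "nat \<Rightarrow> ('f, 'p) fm \<Rightarrow> bool \<Rightarrow> ('f, 'p) fm set \<Rightarrow> bool" where
  "fresh x T d S \<longleftrightarrow> (\<forall>A \<in> S. x \<notin> fv_fm A) \<and> (d \<longrightarrow> x \<notin> fv_fm T)"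

inductive mqcp ::
  "('f \<times> nat) set \<Rightarrow> ('p \<times> nat) set \<Rightarrow> ('f, 'p) fm \<Rightarrow>
   ('f, 'p) fm list \<Rightarrow> bool \<Rightarrow> ('f, 'p) fm \<Rightarrow> bool"
  for F :: "('f \<times> nat) set" and P :: "('p \<times> nat) set" and T :: "('f, 'p) fm"
where
  Ax: "A \<in> set \<Gamma> \<Longrightarrow> list_all (wf_fm F P) \<Gamma> \<Longrightarrow> mqcp F P T \<Gamma> d A"
| AndI: "mqcp F P T \<Gamma> d A \<Longrightarrow> mqcp F P T \<Gamma> d B \<Longrightarrow> mqcp F P T \<Gamma> d (And A B)"
| AndE1: "mqcp F P T \<Gamma> d (And A B) \<Longrightarrow> mqcp F P T \<Gamma> d A"
| AndE2: "mqcp F P T \<Gamma> d (And A B) \<Longrightarrow> mqcp F P T \<Gamma> d B"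
| OrI1: "mqcp F P T \<Gamma> d A \<Longrightarrow> wf_fm F P B \<Longrightarrow> mqcp F P T \<Gamma> d (Or A B)"
| OrI2: "mqcp F P T \<Gamma> d B \<Longrightarrow> wf_fm F P A \<Longrightarrow> mqcp F P T \<Gamma> d (Or A B)"
| OrE: "mqcp F P T \<Gamma> d (Or A B) \<Longrightarrow> mqcp F P T (A # \<Gamma>) d C \<Longrightarrow>
    mqcp F P T (B # \<Gamma>) d C \<Longrightarrow> mqcp F P T \<Gamma> d C"
| ImpI: "mqcp F P T (A # \<Gamma>) d B \<Longrightarrow> mqcp F P T \<Gamma> d (Imp A B)"
| ImpE: "mqcp F P T \<Gamma> d (Imp A B) \<Longrightarrow> mqcp F P T \<Gamma> d A \<Longrightarrow> mqcp F P T \<Gamma> d B"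
| AllI: "mqcp F P T \<Gamma> d (inst A (Var x)) \<Longrightarrow> fresh x T d (insert (All A) (set \<Gamma>)) \<Longrightarrow>
    mqcp F P T \<Gamma> d (All A)"
| AllE: "mqcp F P T \<Gamma> d (All A) \<Longrightarrow> wf_tm F t \<Longrightarrow> mqcp F P T \<Gamma> d (inst A t)"
| ExI: "mqcp F P T \<Gamma> d (inst A t) \<Longrightarrow> wf_tm F t \<Longrightarrow> mqcp F P T \<Gamma> d (Ex A)"
| ExE: "mqcp F P T \<Gamma> d (Ex A) \<Longrightarrow> mqcp F P T (inst A (Var x) # \<Gamma>) d C \<Longrightarrow>
    fresh x T d (insert (Ex A) (insert C (set \<Gamma>))) \<Longrightarrow> mqcp F P T \<Gamma> d C"
| Reset: "mqcp F P T \<Gamma> True T \<Longrightarrow> mqcp F P T \<Gamma> d T"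
| Shift: "mqcp F P T (Imp A T # \<Gamma>) True T \<Longrightarrow> mqcp F P T \<Gamma> True A"

definition provable ::
  "('f \<times> nat) set \<Rightarrow> ('p \<times> nat) set \<Rightarrow> ('f, 'p) fm \<Rightarrow> ('f, 'p) fm \<Rightarrow> bool" where
  "provable F P T A \<longleftrightarrow> mqcp F P T [] False A"

end

theory Submission
  imports Defs
begin

text \<open>
  The language itself, with variables treated as constants, is turned into a classical
  structure in which an atom is true iff it is provable. Where \<open>T\<close> is false in this structure,
  Shift is classically valid, and where \<open>T\<close> is true, Reset is trivially so; hence every
  theorem is true there. For a \<open>\<Sigma>\<close>-formula, truth in this structure implies the slash of Aczel
  and Kleene, so a provable instance of \<open>T\<close> satisfies the slash. This settles Reset, the only
  case of the soundness proof for the slash that goes beyond minimal logic, and the slash yields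
  both properties.
\<close>

section \<open>Substitution\<close>

lemma subst_tm_cong: "(\<And>n. n \<in> fv_tm t \<Longrightarrow> \<sigma> n = \<tau> n) \<Longrightarrow> subst_tm \<sigma> t = subst_tm \<tau> t"
  by (induction t) auto

lemma subst_tm_comp: "subst_tm \<sigma> (subst_tm \<tau> t) = subst_tm (\<lambda>n. subst_tm \<sigma> (\<tau> n)) t"
  by (induction t) auto

lemma subst_tm_Var [simp]: "subst_tm Var t = t"
  by (induction t) (auto simp: map_idI)

lemma wf_tm_subst: "wf_tm F t \<Longrightarrow> (\<And>n. wf_tm F (\<sigma> n)) \<Longrightarrow> wf_tm F (subst_tm \<sigma> t)"
  by (induction t) (auto simp: list_all_iff)

lemma wf_tm_substD: "wf_tm F (subst_tm \<sigma> t) \<Longrightarrow> wf_tm F t"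
  by (induction t) (auto simp: list_all_iff)

lemma fv_tm_subst: "fv_tm (subst_tm \<sigma> t) = (\<Union>n\<in>fv_tm t. fv_tm (\<sigma> n))"
  by (induction t) auto

lemma finite_fv_tm: "finite (fv_tm t)"
  by (induction t) auto

lemma lift_subst_simps [simp]:
  "lift_subst \<sigma> 0 = Var 0"
  "lift_subst \<sigma> (Suc n) = subst_tm (\<lambda>m. Var (Suc m)) (\<sigma> n)"
  by (auto simp: lift_subst_def)

lemma lift_subst_Var [simp]: "lift_subst Var = Var"
  by (auto simp: lift_subst_def split: nat.splits)

lemma lift_subst_comp:
  "(\<lambda>n. subst_tm (lift_subst \<sigma>) (lift_subst \<tau> n)) = lift_subst (\<lambda>n. subst_tm \<sigma> (\<tau> n))"
proof
  show "subst_tm (lift_subst \<sigma>) (lift_subst \<tau> n) = lift_subst (\<lambda>n. subst_tm \<sigma> (\<tau> n)) n" for n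
    by (cases n) (auto simp: subst_tm_comp)
qed

lemma case_nat_lift_subst:
  "(\<lambda>n. subst_tm (case_nat t \<sigma>) (lift_subst \<tau> n)) = case_nat t (\<lambda>n. subst_tm \<sigma> (\<tau> n))"
proof
  show "subst_tm (case_nat t \<sigma>) (lift_subst \<tau> n) = case_nat t (\<lambda>n. subst_tm \<sigma> (\<tau> n)) n" for n
    by (cases n) (auto simp: subst_tm_comp)
qed

lemma wf_lift_subst: "(\<And>n. wf_tm F (\<sigma> n)) \<Longrightarrow> wf_tm F (lift_subst \<sigma> n)"
  by (cases n) (auto intro: wf_tm_subst)

lemma subst_fm_cong: "(\<And>n. n \<in> fv_fm A \<Longrightarrow> \<sigma> n = \<tau> n) \<Longrightarrow> subst_fm \<sigma> A = subst_fm \<tau> A"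
proof (induction A arbitrary: \<sigma> \<tau>)
  case (Pred p ts)
  then show ?case by (auto intro!: subst_tm_cong)
next
  case (Ex A)
  have "lift_subst \<sigma> n = lift_subst \<tau> n" if "n \<in> fv_fm A" for n
    using Ex.prems that by (cases n) auto
  then show ?case using Ex.IH[of "lift_subst \<sigma>" "lift_subst \<tau>"] by simp
next
  case (All A)
  have "lift_subst \<sigma> n = lift_subst \<tau> n" if "n \<in> fv_fm A" for n
    using All.prems that by (cases n) auto
  then show ?case using All.IH[of "lift_subst \<sigma>" "lift_subst \<tau>"] by simp
next
  case (And A B)
  show ?case using And.IH[of \<sigma> \<tau>] And.prems by simp
next
  case (Or A B)
  show ?case using Or.IH[of \<sigma> \<tau>] Or.prems by simp
next
  case (Imp A B)
  show ?case using Imp.IH[of \<sigma> \<tau>] Imp.prems by simp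
qed

lemma subst_fm_comp: "subst_fm \<sigma> (subst_fm \<tau> A) = subst_fm (\<lambda>n. subst_tm \<sigma> (\<tau> n)) A"
  by (induction A arbitrary: \<sigma> \<tau>) (auto simp: subst_tm_comp lift_subst_comp)

lemma subst_fm_Var [simp]: "subst_fm Var A = A"
  by (induction A) (auto simp: map_idI)

lemma wf_fm_subst: "wf_fm F P A \<Longrightarrow> (\<And>n. wf_tm F (\<sigma> n)) \<Longrightarrow> wf_fm F P (subst_fm \<sigma> A)"
  by (induction A arbitrary: \<sigma>) (auto simp: list_all_iff wf_lift_subst intro: wf_tm_subst)

text \<open>Substitution keeps every symbol of the formula with its number of arguments. This serves
  rules such as \<open>ExI\<close>, whose premise shows only an instance of the body.\<close>

lemma wf_fm_substD: "wf_fm F P (subst_fm \<sigma> A) \<Longrightarrow> wf_fm F P A"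
  by (induction A arbitrary: \<sigma>) (auto simp: list_all_iff intro: wf_tm_substD)

lemma finite_fv_fm: "finite (fv_fm A)"
proof (induction A)
  case (Ex A)
  then show ?case using finite_vimageI[of "fv_fm A" Suc] by (simp add: vimage_def)
next
  case (All A)
  then show ?case using finite_vimageI[of "fv_fm A" Suc] by (simp add: vimage_def)
qed (auto simp: finite_fv_tm)

lemma inst_lift_subst: "inst (subst_fm (lift_subst \<sigma>) A) t = subst_fm (case_nat t \<sigma>) A"
  by (simp add: inst_def subst_fm_comp case_nat_lift_subst)

text \<open>The binder step shared by \<open>Ex\<close> and \<open>All\<close> in
  \<open>fv_fm_subst\<close>; the second assumption is the induction hypothesis for the body. Index
  0 is sent to \<open>Var 0\<close>, so a successor can only come from a successor.\<close>

lemma fv_subst_lift: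
  assumes "Suc n \<in> fv_fm (subst_fm (lift_subst \<sigma>) A)"
    and "\<And>\<sigma> n. n \<in> fv_fm (subst_fm \<sigma> A) \<Longrightarrow> \<exists>m\<in>fv_fm A. n \<in> fv_tm (\<sigma> m)"
  shows "\<exists>m. Suc m \<in> fv_fm A \<and> n \<in> fv_tm (\<sigma> m)"
proof -
  obtain m where m: "m \<in> fv_fm A" "Suc n \<in> fv_tm (lift_subst \<sigma> m)"
    using assms by blast
  then show ?thesis by (cases m) (auto simp: fv_tm_subst)
qed

lemma fv_fm_subst: "n \<in> fv_fm (subst_fm \<sigma> A) \<Longrightarrow> \<exists>m\<in>fv_fm A. n \<in> fv_tm (\<sigma> m)"
proof (induction A arbitrary: n \<sigma>)
  case (Pred p ts)
  then show ?case by (auto simp: fv_tm_subst)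
next
  case (Ex A)
  then show ?case using fv_subst_lift[of n \<sigma> A] by auto
next
  case (All A)
  then show ?case using fv_subst_lift[of n \<sigma> A] by auto
qed (simp, metis UnE UnI1 UnI2)+

section \<open>Derivability under substitution\<close>

lemma mqcp_wf:
  assumes "mqcp F P T \<Gamma> d A" "wf_fm F P T"
  shows "wf_fm F P A \<and> list_all (wf_fm F P) \<Gamma>"
  using assms
  by (induction rule: mqcp.induct)
    (auto simp: list_all_iff inst_def intro: wf_fm_substD intro!: wf_fm_subst split: nat.splits)

text \<open>
  Derivations with annotation are not closed under substitution, since \<open>T\<close> would change.
  Without annotation one may generalise even over variables that are free in \<open>T\<close>.
\<close>

lemma provable_subst_single:
  assumes "provable F P T A" "wf_tm F t"
  shows "provable F P T (subst_fm (Var(x := t)) A)"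
proof -
  \<comment> \<open>\<open>B\<close> is the body obtained by binding \<open>x\<close> in
    \<open>A\<close>: \<open>x\<close> becomes index 0 and all other variables move up by
    one.\<close>
  define B where "B = subst_fm (\<lambda>n. if n = x then Var 0 else Var (Suc n)) A"
  have B: "inst B s = subst_fm (Var(x := s)) A" for s
    unfolding B_def inst_def subst_fm_comp by (rule subst_fm_cong) auto
  have "mqcp F P T [] False (inst B (Var x))"
    using assms(1) by (simp add: B provable_def fun_upd_triv)
  moreover have "x \<notin> fv_fm (All B)"
    unfolding B_def by (auto dest!: fv_fm_subst split: if_splits)
  ultimately have "mqcp F P T [] False (All B)"
    by (auto intro!: AllI simp: fresh_def)
  then have "mqcp F P T [] False (inst B t)"
    using assms(2) by (rule AllE)
  then show ?thesis by (simp add: B provable_def)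
qed

lemma provable_subst:
  assumes "provable F P T A" and wf: "\<And>n. wf_tm F (\<sigma> n)"
  shows "provable F P T (subst_fm \<sigma> A)"
proof -
  \<comment> \<open>Indices from \<open>N\<close> on are fresh both for \<open>A\<close> and for the
    terms put into it.\<close>
  obtain N where N': "\<forall>n \<in> fv_fm A \<union> (\<Union>n\<in>fv_fm A. fv_tm (\<sigma> n)). n < N"
    using finite_nat_set_iff_bounded[of "fv_fm A \<union> (\<Union>n\<in>fv_fm A. fv_tm (\<sigma> n))"]
    by (auto simp: finite_fv_fm finite_fv_tm)
  have N: "n < N" "m \<in> fv_tm (\<sigma> n) \<Longrightarrow> m < N" if "n \<in> fv_fm A" for n m
    using N' that by blast+
  \<comment> \<open>The variables are first moved to fresh ones, so that the single substitutions that
    follow do not interfere.\<close>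
  have rename: "k \<le> N \<Longrightarrow> provable F P T (subst_fm (\<lambda>n. if n < k then Var (n + N) else Var n) A)" for k
  proof (induction k)
    case 0
    then show ?case using assms(1) by simp
  next
    case (Suc k)
    have "provable F P T (subst_fm (Var(k := Var (k + N)))
        (subst_fm (\<lambda>n. if n < k then Var (n + N) else Var n) A))"
      using Suc by (intro provable_subst_single) auto
    also have "subst_fm (Var(k := Var (k + N)))
        (subst_fm (\<lambda>n. if n < k then Var (n + N) else Var n) A)
      = subst_fm (\<lambda>n. if n < Suc k then Var (n + N) else Var n) A"
      \<comment> \<open>Since \<open>k < N\<close>, no variable \<open>n + N\<close> already
        introduced equals \<open>k\<close>.\<close>
      unfolding subst_fm_comp using Suc.prems by (intro subst_fm_cong) auto
    finally show ?case .
  qed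
  have "provable F P T (subst_fm (\<lambda>n. if n < k then \<sigma> n else Var (n + N)) A)" for k
  proof (induction k)
    case 0
    have "subst_fm (\<lambda>n. if n < N then Var (n + N) else Var n) A
        = subst_fm (\<lambda>n. if n < 0 then \<sigma> n else Var (n + N)) A"
      using N(1) by (intro subst_fm_cong) auto
    then show ?case using rename[of N] by simp
  next
    case (Suc k)
    have "provable F P T (subst_fm (Var(k + N := \<sigma> k))
        (subst_fm (\<lambda>n. if n < k then \<sigma> n else Var (n + N)) A))"
      using Suc wf by (intro provable_subst_single) auto
    also have "subst_fm (Var(k + N := \<sigma> k))
        (subst_fm (\<lambda>n. if n < k then \<sigma> n else Var (n + N)) A)
      = subst_fm (\<lambda>n. if n < Suc k then \<sigma> n else Var (n + N)) A"
      unfolding subst_fm_comp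
    proof (rule subst_fm_cong)
      fix n assume n: "n \<in> fv_fm A"
      \<comment> \<open>The terms already inserted have only variables below \<open>N\<close>, so
        replacing \<open>k + N\<close> leaves them alone.\<close>
      have "subst_tm (Var(k + N := \<sigma> k)) (\<sigma> n) = subst_tm Var (\<sigma> n)"
        using N(2)[OF n] by (intro subst_tm_cong) fastforce
      then show "subst_tm (Var(k + N := \<sigma> k)) (if n < k then \<sigma> n else Var (n + N))
          = (if n < Suc k then \<sigma> n else Var (n + N))"
        by (auto simp: less_Suc_eq)
    qed
    finally show ?case .
  qed
  moreover have "subst_fm (\<lambda>n. if n < N then \<sigma> n else Var (n + N)) A = subst_fm \<sigma> A"
    using N(1) by (intro subst_fm_cong) auto
  ultimately show ?thesis by metis
qed

text \<open>Discharging the context by \<open>ImpI\<close> leads to the empty context, where closure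
  under substitution is available; \<open>ImpE\<close> then consumes the provable instances one by
  one.\<close>

lemma provable_cut:
  assumes "mqcp F P T \<Gamma> False A" "\<And>n. wf_tm F (\<sigma> n)"
    and "\<And>C. C \<in> set \<Gamma> \<Longrightarrow> provable F P T (subst_fm \<sigma> C)"
  shows "provable F P T (subst_fm \<sigma> A)"
  using assms
proof (induction \<Gamma> arbitrary: A)
  case Nil
  then show ?case using provable_subst[of F P T A \<sigma>] by (simp add: provable_def)
next
  case (Cons C \<Gamma>)
  have "provable F P T (subst_fm \<sigma> (Imp C A))"
    by (rule Cons.IH[OF ImpI[OF Cons.prems(1)]]) (auto intro: Cons.prems)
  moreover have "provable F P T (subst_fm \<sigma> C)"
    using Cons.prems by simp
  ultimately show ?case by (auto simp: provable_def intro: ImpE)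
qed

section \<open>Truth and slash\<close>

text \<open>
  \<open>\<sigma>\<close> is the valuation of the free variables by terms. Taking the constantly true predicate
  for \<open>R\<close> gives truth in the classical structure, and taking provability for \<open>R\<close> gives the slash.
\<close>

primrec holds ::
  "('f \<times> nat) set \<Rightarrow> (('f, 'p) fm \<Rightarrow> bool) \<Rightarrow> (('f, 'p) fm \<Rightarrow> bool) \<Rightarrow>
   (nat \<Rightarrow> 'f tm) \<Rightarrow> ('f, 'p) fm \<Rightarrow> bool" where
  "holds F Q R \<sigma> (Pred p ts) \<longleftrightarrow> Q (subst_fm \<sigma> (Pred p ts))"
| "holds F Q R \<sigma> (And A B) \<longleftrightarrow> holds F Q R \<sigma> A \<and> holds F Q R \<sigma> B"
| "holds F Q R \<sigma> (Or A B) \<longleftrightarrow> holds F Q R \<sigma> A \<or> holds F Q R \<sigma> B"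
| "holds F Q R \<sigma> (Imp A B) \<longleftrightarrow>
    R (subst_fm \<sigma> (Imp A B)) \<and> (holds F Q R \<sigma> A \<longrightarrow> holds F Q R \<sigma> B)"
| "holds F Q R \<sigma> (Ex A) \<longleftrightarrow> (\<exists>t. wf_tm F t \<and> holds F Q R (case_nat t \<sigma>) A)"
| "holds F Q R \<sigma> (All A) \<longleftrightarrow> (\<forall>t. wf_tm F t \<longrightarrow> holds F Q R (case_nat t \<sigma>) A)"

lemma holds_cong:
  "(\<And>n. n \<in> fv_fm A \<Longrightarrow> \<sigma> n = \<tau> n) \<Longrightarrow> holds F Q R \<sigma> A = holds F Q R \<tau> A"
proof (induction A arbitrary: \<sigma> \<tau>)
  case (Pred p ts)
  then show ?case using subst_fm_cong[of "Pred p ts" \<sigma> \<tau>] by (simp del: subst_fm.simps)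
next
  case (Imp A B)
  have "holds F Q R \<sigma> A = holds F Q R \<tau> A" "holds F Q R \<sigma> B = holds F Q R \<tau> B"
    by (rule Imp.IH, simp add: Imp.prems)+
  moreover have "subst_fm \<sigma> (Imp A B) = subst_fm \<tau> (Imp A B)"
    using Imp.prems by (rule subst_fm_cong)
  ultimately show ?case by (simp del: subst_fm.simps)
next
  case (Ex A)
  have "holds F Q R (case_nat t \<sigma>) A = holds F Q R (case_nat t \<tau>) A" for t
    using Ex.prems by (intro Ex.IH) (auto split: nat.splits)
  then show ?case by simp
next
  case (All A)
  have "holds F Q R (case_nat t \<sigma>) A = holds F Q R (case_nat t \<tau>) A" for t
    using All.prems by (intro All.IH) (auto split: nat.splits)
  then show ?case by simp
next
  case (And A B)
  show ?case using And.IH[of \<sigma> \<tau>] And.prems by simp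
next
  case (Or A B)
  show ?case using Or.IH[of \<sigma> \<tau>] Or.prems by simp
qed

lemma holds_subst:
  "holds F Q R \<sigma> (subst_fm \<tau> A) = holds F Q R (\<lambda>n. subst_tm \<sigma> (\<tau> n)) A"
  by (induction A arbitrary: \<sigma> \<tau>)
    (auto simp: subst_tm_comp subst_fm_comp lift_subst_comp case_nat_lift_subst comp_def)

lemma holds_inst: "holds F Q R \<sigma> (inst A t) = holds F Q R (case_nat (subst_tm \<sigma> t) \<sigma>) A"
proof -
  have "(\<lambda>n. subst_tm \<sigma> (case_nat t Var n)) = case_nat (subst_tm \<sigma> t) \<sigma>"
    by (auto split: nat.splits)
  then show ?thesis by (simp add: inst_def holds_subst)
qed

text \<open>Serves the eigenvariable rules: the value given to \<open>x\<close> becomes the element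
  bound by the quantifier. Under that binder \<open>x\<close> is the index
  \<open>Suc x\<close>.\<close>

lemma holds_inst_fresh:
  assumes "Suc x \<notin> fv_fm A"
  shows "holds F Q R (\<sigma>(x := t)) (inst A (Var x)) = holds F Q R (case_nat t \<sigma>) A"
  unfolding holds_inst using assms by (intro holds_cong) (auto split: nat.splits)

lemma holds_upd: "x \<notin> fv_fm A \<Longrightarrow> holds F Q R (\<sigma>(x := t)) A = holds F Q R \<sigma> A"
  by (rule holds_cong) auto

text \<open>
  The predicate \<open>ok\<close> singles out the valuations for which a sequent is to be valid. It allows
  one induction to serve both truth and slash.
\<close>

lemma mqcp_sound:
  assumes "mqcp F P T \<Gamma> d A"
    and imp: "\<And>\<Gamma> d A B \<sigma>. mqcp F P T \<Gamma> d (Imp A B) \<Longrightarrow> ok d \<sigma> \<Longrightarrow> \<forall>n. wf_tm F (\<sigma> n) \<Longrightarrow>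
        \<forall>C\<in>set \<Gamma>. holds F Q R \<sigma> C \<Longrightarrow> R (subst_fm \<sigma> (Imp A B))"
    and upd: "\<And>d \<sigma> x t. ok d \<sigma> \<Longrightarrow> (d \<Longrightarrow> x \<notin> fv_fm T) \<Longrightarrow> ok d (\<sigma>(x := t))"
    and reset: "\<And>\<Gamma> d \<sigma>. mqcp F P T \<Gamma> True T \<Longrightarrow> (ok True \<sigma> \<Longrightarrow> holds F Q R \<sigma> T) \<Longrightarrow>
        ok d \<sigma> \<Longrightarrow> \<forall>n. wf_tm F (\<sigma> n) \<Longrightarrow> \<forall>C\<in>set \<Gamma>. holds F Q R \<sigma> C \<Longrightarrow> holds F Q R \<sigma> T"
    and shift: "\<And>\<sigma> A. ok True \<sigma> \<Longrightarrow> \<not> holds F Q R \<sigma> T \<and> R A"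
    and "ok d \<sigma>" "\<forall>n. wf_tm F (\<sigma> n)" "\<forall>C\<in>set \<Gamma>. holds F Q R \<sigma> C"
  shows "holds F Q R \<sigma> A"
  using assms(1,6-)
proof (induction arbitrary: \<sigma> rule: mqcp.induct)
  case (ImpI A \<Gamma> d B)
  have "mqcp F P T \<Gamma> d (Imp A B)" using ImpI.hyps by (rule mqcp.ImpI)
  then have "R (subst_fm \<sigma> (Imp A B))" using ImpI.prems by (rule imp)
  then show ?case using ImpI by simp
next
  case (AllI \<Gamma> d A x)
  have x: "Suc x \<notin> fv_fm A" "d \<Longrightarrow> x \<notin> fv_fm T" "\<forall>C\<in>set \<Gamma>. x \<notin> fv_fm C"
    using AllI.hyps by (auto simp: fresh_def)
  have "holds F Q R (\<sigma>(x := t)) (inst A (Var x))" if "wf_tm F t" for t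
  proof (rule AllI.IH)
    show "ok d (\<sigma>(x := t))" using AllI.prems(1) x(2) by (rule upd)
    show "\<forall>n. wf_tm F ((\<sigma>(x := t)) n)" using AllI.prems(2) that by simp
    show "\<forall>C\<in>set \<Gamma>. holds F Q R (\<sigma>(x := t)) C"
      using AllI.prems(3) x(3) by (simp add: holds_upd del: fun_upd_apply)
  qed
  then show ?case by (simp add: holds_inst_fresh x)
next
  case (AllE \<Gamma> d A t)
  then show ?case by (simp add: holds_inst wf_tm_subst)
next
  case (ExI \<Gamma> d A t)
  then have "holds F Q R (case_nat (subst_tm \<sigma> t) \<sigma>) A" by (simp add: holds_inst)
  moreover have "wf_tm F (subst_tm \<sigma> t)" using ExI by (simp add: wf_tm_subst)
  ultimately show ?case by auto
next
  case (ExE \<Gamma> d A x C)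
  have x: "Suc x \<notin> fv_fm A" "d \<Longrightarrow> x \<notin> fv_fm T" "\<forall>C\<in>set \<Gamma>. x \<notin> fv_fm C" "x \<notin> fv_fm C"
    using ExE.hyps by (auto simp: fresh_def)
  have "holds F Q R \<sigma> (Ex A)" using ExE by blast
  then obtain t where t: "wf_tm F t" "holds F Q R (case_nat t \<sigma>) A" by auto
  have "holds F Q R (\<sigma>(x := t)) C"
  proof (rule ExE.IH)
    show "ok d (\<sigma>(x := t))" using ExE.prems(1) x(2) by (rule upd)
    show "\<forall>n. wf_tm F ((\<sigma>(x := t)) n)" using ExE.prems(2) t(1) by simp
    show "\<forall>C\<in>set (inst A (Var x) # \<Gamma>). holds F Q R (\<sigma>(x := t)) C"
      using ExE.prems(3) t(2) x(1,3) by (simp add: holds_inst_fresh holds_upd del: fun_upd_apply)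
  qed
  then show ?case by (simp add: holds_upd x)
next
  case (Reset \<Gamma> d)
  \<comment> \<open>\<open>reset\<close> receives the induction hypothesis as an implication,
    because the annotated premise is valid only under \<open>ok True \<sigma>\<close>.\<close>
  show ?case using Reset.hyps _ Reset.prems by (rule reset) (rule Reset.IH, use Reset.prems in auto)
next
  case (Shift A \<Gamma>)
  show ?case
  \<comment> \<open>If \<open>A\<close> fails, then \<open>Imp A T\<close> holds vacuously, its
    \<open>R\<close> part being supplied by \<open>shift\<close>. The induction hypothesis then
    makes \<open>T\<close> true, against \<open>shift\<close>.\<close>
  proof (rule ccontr)
    assume "\<not> holds F Q R \<sigma> A"
    then have "holds F Q R \<sigma> (Imp A T)"
      unfolding holds.simps using shift[OF Shift.prems(1)] by blast
    then have "holds F Q R \<sigma> T"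
      using Shift.prems by (intro Shift.IH) (simp_all del: holds.simps)
    then show False using shift Shift.prems(1) by blast
  qed
qed auto

section \<open>Soundness of truth and of the slash\<close>

text \<open>Annotated sequents are required to be valid only where \<open>T\<close> is false. For
  Reset, validity of the premise then says that \<open>T\<close> is true if it is false, hence
  true.\<close>

lemma truth_sound:
  assumes "mqcp F P T \<Gamma> False A" "\<forall>n. wf_tm F (\<sigma> n)"
    and "\<forall>C\<in>set \<Gamma>. holds F Q (\<lambda>_. True) \<sigma> C"
  shows "holds F Q (\<lambda>_. True) \<sigma> A"
  using assms(1) _ _ _ _ _ assms(2,3)
  by (rule mqcp_sound[where ok = "\<lambda>d \<sigma>. d \<longrightarrow> \<not> holds F Q (\<lambda>_. True) \<sigma> T"])
    (auto simp: holds_upd)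

text \<open>\<open>R\<close> enters only through the clause for \<open>Imp\<close>, so truth and
  slash agree on formulas without implication.\<close>

lemma holds_sigma:
  "sigma_fm A \<Longrightarrow> holds F Q R \<sigma> A = holds F Q R' \<sigma> A"
  by (induction A arbitrary: \<sigma>) auto

text \<open>For \<open>Imp\<close> provability is part of the slash; for compound formulas of the
  other kinds it is rebuilt by the introduction rules.\<close>

lemma slash_imp_provable:
  assumes "holds F (provable F P T) (provable F P T) \<sigma> A" "wf_fm F P A" "\<forall>n. wf_tm F (\<sigma> n)"
  shows "provable F P T (subst_fm \<sigma> A)"
  using assms
proof (induction A arbitrary: \<sigma>)
  case (And A B)
  then show ?case by (auto simp: provable_def intro: AndI)
next
  case (Or A B)
  then show ?case by (auto simp: provable_def wf_fm_subst intro: OrI1 OrI2)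
next
  case (Ex A)
  then obtain t where t: "wf_tm F t" "holds F (provable F P T) (provable F P T) (case_nat t \<sigma>) A"
    by auto
  have "provable F P T (subst_fm (case_nat t \<sigma>) A)"
    using Ex t by (intro Ex.IH) (auto split: nat.splits)
  then show ?case
    using t by (auto simp: provable_def inst_lift_subst[symmetric] intro: ExI)
next
  case (All A)
  \<comment> \<open>Quantifiers range over open terms too, so a fresh variable is available as a
    generic element.\<close>
  obtain x where x: "x \<notin> fv_fm (subst_fm \<sigma> (All A))"
    using ex_new_if_finite[OF infinite_UNIV_nat finite_fv_fm] by blast
  have "provable F P T (subst_fm (case_nat (Var x) \<sigma>) A)"
    using All by (intro All.IH) (auto split: nat.splits)
  then show ?case
    using x by (auto simp: provable_def inst_lift_subst[symmetric] fresh_def intro!: AllI)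
qed auto

text \<open>The choice of \<open>ok\<close> makes a claim for unannotated sequents only. Shift
  becomes vacuous, while Reset must be settled without its induction hypothesis.\<close>

lemma slash_sound:
  assumes T: "wf_fm F P T" "sigma_fm T"
    and "mqcp F P T \<Gamma> False A" "\<forall>n. wf_tm F (\<sigma> n)"
    and "\<forall>C\<in>set \<Gamma>. holds F (provable F P T) (provable F P T) \<sigma> C"
  shows "holds F (provable F P T) (provable F P T) \<sigma> A"
proof (rule mqcp_sound[where ok = "\<lambda>d \<sigma>. \<not> d", OF assms(3) _ _ _ _ _ assms(4,5)])
  have cut: "provable F P T (subst_fm \<sigma> A)"
    if "mqcp F P T \<Gamma> False A" "\<forall>n. wf_tm F (\<sigma> n)"
      "\<forall>C\<in>set \<Gamma>. holds F (provable F P T) (provable F P T) \<sigma> C" for \<Gamma> A \<sigma>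
  proof (rule provable_cut[OF that(1)])
    show "wf_tm F (\<sigma> n)" for n using that(2) by blast
    have "wf_fm F P C" if "C \<in> set \<Gamma>" for C
      using mqcp_wf[OF \<open>mqcp F P T \<Gamma> False A\<close> T(1)] that by (simp add: list_all_iff)
    then show "provable F P T (subst_fm \<sigma> C)" if "C \<in> set \<Gamma>" for C
      using that \<open>\<forall>n. wf_tm F (\<sigma> n)\<close>
        \<open>\<forall>C\<in>set \<Gamma>. holds F (provable F P T) (provable F P T) \<sigma> C\<close>
      by (intro slash_imp_provable) blast+
  qed
  show "provable F P T (subst_fm \<sigma> (Imp A B))"
    if "mqcp F P T \<Gamma> d (Imp A B)" "\<not> d" "\<forall>n. wf_tm F (\<sigma> n)"
      "\<forall>C\<in>set \<Gamma>. holds F (provable F P T) (provable F P T) \<sigma> C" for \<Gamma> d A B \<sigma>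
    using cut[of \<Gamma> "Imp A B" \<sigma>] that by simp
  show "holds F (provable F P T) (provable F P T) \<sigma> T"
    if \<Gamma>: "mqcp F P T \<Gamma> True T" "\<forall>n. wf_tm F (\<sigma> n)"
      "\<forall>C\<in>set \<Gamma>. holds F (provable F P T) (provable F P T) \<sigma> C" for \<Gamma> \<sigma>
  proof -
    \<comment> \<open>Reset erases the annotation, so \<open>cut\<close> applies. The resulting
      theorem has an empty context and is therefore true under the identity valuation.\<close>
    have "provable F P T (subst_fm \<sigma> T)"
      using Reset[OF \<Gamma>(1)] \<Gamma>(2,3) by (rule cut)
    then have "holds F (provable F P T) (\<lambda>_. True) Var (subst_fm \<sigma> T)"
      unfolding provable_def by (rule truth_sound) auto
    then have "holds F (provable F P T) (\<lambda>_. True) \<sigma> T"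
      by (simp add: holds_subst)
    then show ?thesis using holds_sigma[OF T(2)] by blast
  qed
qed auto

section \<open>The disjunction and existence properties\<close>

theorem corollary4p9:
  fixes F :: "('f \<times> nat) set" and P :: "('p \<times> nat) set" and T :: "('f, 'p) fm"
  assumes "wf_fm F P T" and "sigma_fm T"
  shows "(\<forall>A B. provable F P T (Or A B) \<longrightarrow> provable F P T A \<or> provable F P T B) \<and>
    ((\<exists>s. closed_tm F s) \<longrightarrow>
      (\<forall>A. fv_fm (Ex A) = {} \<longrightarrow> provable F P T (Ex A) \<longrightarrow>
        (\<exists>t. closed_tm F t \<and> provable F P T (inst A t))))"
proof (intro conjI allI impI)
  \<comment> \<open>The valuation \<open>Var\<close> reads a formula as it stands, its variables
    acting as constants.\<close>
  have slash: "holds F (provable F P T) (provable F P T) Var A" "wf_fm F P A"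
    if "provable F P T A" for A
    using that slash_sound[OF assms, of "[]" A Var] mqcp_wf[OF _ assms(1)]
    by (auto simp: provable_def)
  show "provable F P T A \<or> provable F P T B" if "provable F P T (Or A B)" for A B
    using slash[OF that] slash_imp_provable[of F P T Var A] slash_imp_provable[of F P T Var B]
    by auto
  show "\<exists>t. closed_tm F t \<and> provable F P T (inst A t)"
    if s: "\<exists>s. closed_tm F s" and A: "fv_fm (Ex A) = {}" "provable F P T (Ex A)" for A
  proof -
    obtain s where s: "wf_tm F s" "fv_tm s = {}"
      using s by (auto simp: closed_tm_def)
    obtain t where t: "wf_tm F t" "holds F (provable F P T) (provable F P T) (case_nat t Var) A"
      using slash(1)[OF A(2)] by auto
    have "provable F P T (inst A t)"
      unfolding inst_def using t slash(2)[OF A(2)]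
      by (intro slash_imp_provable) (auto split: nat.splits)
    \<comment> \<open>The witness may contain variables, which are now replaced by a closed term.\<close>
    then have "provable F P T (subst_fm (\<lambda>_. s) (inst A t))"
      using s by (intro provable_subst)
    \<comment> \<open>As \<open>Ex A\<close> is closed, at most index 0 is free in \<open>A\<close>,
      so the constant valuation acts on the witness alone.\<close>
    also have "subst_fm (\<lambda>_. s) (inst A t) = inst A (subst_tm (\<lambda>_. s) t)"
      unfolding inst_def subst_fm_comp using A(1)
      by (intro subst_fm_cong) (auto split: nat.splits)
    finally have "provable F P T (inst A (subst_tm (\<lambda>_. s) t))" .
    moreover have "closed_tm F (subst_tm (\<lambda>_. s) t)"
      using s t by (simp add: closed_tm_def fv_tm_subst wf_tm_subst)
    ultimately show ?thesis by blast
  qed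
qed

end
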